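(* Let $s\in\mathbb{R}\setminus\{0\}$ and let $\hat G:(0,2)\to\mathbb{R}$ be $$\hat G(\Delta)=4s^2\Delta\left[\frac{4-\Delta^2}{4+\Delta^2}+2\log\frac{4\Delta}{4+\Delta^2}\right].$$ Then: (i) $\hat G$ has exactly one zero $\Delta_{\mathrm{eq}}$ in the open interval $(0,2)$; computed numerically, it is approximately given by $\Delta_{\mathrm{eq}}\simeq 0.8$. (ii) $\hat G(\Delta)/s^2\sim 8\Delta\log\Delta$ as $\Delta\to0^+$, and $\hat G(\Delta)/s^2\sim4(2-\Delta)$ as $\Delta\to2^-$ (where $\sim$ denotes equality of principal parts, i.e. the ratio tends to $1$). (iii) For $\Delta_0\in(0,2)$ consider the Cauchy problem $\dot\Delta(T)=\hat G(\Delta(T))$ for $T>0$, $\Delta(0)=\Delta_0$. The value $\Delta_{\mathrm{eq}}$ is its sole equilibrium configuration and it is unstable: if $\Delta_0<\Delta_{\mathrm{eq}}$, then $\Delta(T)\to0^+$ as $T\to+\infty$; if $\Delta_0>\Delta_{\mathrm{eq}}$, then $\Delta(T)\to2^-$ as $T\to+\infty$.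
   Context: This equation describes the non-dimensional distance $\Delta=|\Xi_1-\Xi_2|$ between two wedge disclinations in the unit disk with opposite Frank angles $s_1=-s_2=s$, placed symmetrically with respect to the origin, $\Xi_1=(\Delta/2,0)$ and $\Xi_2=(-\Delta/2,0)$. A dot denotes $\mathrm{d}/\mathrm{d}T$. *)

theory Defs
  imports Complex_Main "HOL-Library.Landau_Symbols"
begin

text \<open>The formula is only meaningful, and only used, for \<open>0 < \<Delta> < 2\<close>.\<close>

definition Ghat :: "real \<Rightarrow> real \<Rightarrow> real" where
  "Ghat s \<Delta> = 4 * s\<^sup>2 * \<Delta> *
     ((4 - \<Delta>\<^sup>2) / (4 + \<Delta>\<^sup>2) + 2 * ln (4 * \<Delta> / (4 + \<Delta>\<^sup>2)))"

text \<open>A global forward solution of \<open>x' = f x\<close> for \<open>T > 0\<close> with initial datum \<open>x0\<close>, where \<open>D\<close> is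
  the domain of \<open>f\<close>. The equation is required for positive times only, so continuity at time \<open>0\<close> is
  what links the solution to its initial datum. Values at negative times are irrelevant.\<close>

definition cauchy_solution ::
    "(real \<Rightarrow> real) \<Rightarrow> real set \<Rightarrow> real \<Rightarrow> (real \<Rightarrow> real) \<Rightarrow> bool" where
  "cauchy_solution f D x0 x \<longleftrightarrow>
     x 0 = x0 \<and> continuous_on {0..} x \<and> (\<forall>T\<ge>0. x T \<in> D) \<and>
     (\<forall>T>0. (x has_real_derivative f (x T)) (at T))"

definition equilibrium :: "(real \<Rightarrow> real) \<Rightarrow> real set \<Rightarrow> real \<Rightarrow> bool" where
  "equilibrium f D xe \<longleftrightarrow> cauchy_solution f D xe (\<lambda>_. xe)"

text \<open>Stability in the sense of Lyapunov.\<close>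

definition stable_equilibrium :: "(real \<Rightarrow> real) \<Rightarrow> real set \<Rightarrow> real \<Rightarrow> bool" where
  "stable_equilibrium f D xe \<longleftrightarrow> equilibrium f D xe \<and>
     (\<forall>\<epsilon>>0. \<exists>\<delta>>0. \<forall>x0\<in>D. \<bar>x0 - xe\<bar> < \<delta> \<longrightarrow>
        (\<forall>x. cauchy_solution f D x0 x \<longrightarrow> (\<forall>T\<ge>0. \<bar>x T - xe\<bar> < \<epsilon>)))"

definition unstable_equilibrium :: "(real \<Rightarrow> real) \<Rightarrow> real set \<Rightarrow> real \<Rightarrow> bool" where
  "unstable_equilibrium f D xe \<longleftrightarrow> equilibrium f D xe \<and> \<not> stable_equilibrium f D xe"

end

theory Submission
  imports Defs "HOL-Analysis.Henstock_Kurzweil_Integration" "HOL-Real_Asymp.Real_Asymp"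
begin

text \<open>Writing \<open>Ghat s x = 4 * s\<^sup>2 * x * bracket x\<close>, the bracket increases and then decreases to its
  value \<open>0\<close> at \<open>2\<close>, so it has a single zero, negative to the left and positive to the right.
  Since \<open>Ghat s\<close> has derivative at most \<open>12 * s\<^sup>2\<close>, forward solutions are unique. They are obtained by
  separation of variables, and they exist for all times because \<open>8 * s\<^sup>2 * x * ln (x / 2) \<le> Ghat s x\<close>
  and \<open>Ghat s x \<le> 8 * s\<^sup>2 * (2 - x)\<close> make the travel time to either endpoint infinite.\<close>

section \<open>Forward uniqueness and equilibria of autonomous equations\<close>

text \<open>Gronwall argument: the one-sided Lipschitz condition makes the squared distance of two
  solutions, weighted by \<open>exp (- 2 * K * t)\<close>, nonincreasing, and it starts at
  \<open>0\<close>.\<close>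

lemma cauchy_solution_unique:
  assumes osl: "\<And>u v. u \<in> D \<Longrightarrow> v \<in> D \<Longrightarrow> (f u - f v) * (u - v) \<le> K * (u - v)\<^sup>2"
    and x: "cauchy_solution f D x0 x" and y: "cauchy_solution f D x0 y" and "0 \<le> T"
  shows "x T = y T"
proof -
  define E where "E = (\<lambda>t. (x t - y t)\<^sup>2 * exp (- 2 * K * t))"
  note sol = x[unfolded cauchy_solution_def] y[unfolded cauchy_solution_def]
  have "E T \<le> E 0"
  proof (rule DERIV_nonpos_imp_decreasing_open[OF \<open>0 \<le> T\<close>])
    fix t assume t: "0 < t" "t < T"
    have dx: "(x has_real_derivative f (x t)) (at t)" and dy: "(y has_real_derivative f (y t)) (at t)"
      and D: "x t \<in> D" "y t \<in> D"
      using sol t by auto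
    have "(E has_real_derivative
        2 * ((f (x t) - f (y t)) * (x t - y t) - K * (x t - y t)\<^sup>2) * exp (- 2 * K * t)) (at t)"
      unfolding E_def
      by (rule derivative_eq_intros dx dy refl | simp add: algebra_simps power2_eq_square)+
    moreover have "2 * ((f (x t) - f (y t)) * (x t - y t) - K * (x t - y t)\<^sup>2) * exp (- 2 * K * t) \<le> 0"
      using osl[OF D] by (simp add: mult_le_0_iff)
    ultimately show "\<exists>z. (E has_real_derivative z) (at t) \<and> z \<le> 0" by blast
  next
    have "continuous_on {0..T} x" "continuous_on {0..T} y"
      using sol by (auto intro: continuous_on_subset)
    then show "continuous_on {0..T} E"
      unfolding E_def by (intro continuous_intros)
  qed
  then have "(x T - y T)\<^sup>2 * exp (- 2 * K * T) \<le> 0"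
    using sol by (simp add: E_def)
  then show ?thesis by (simp add: mult_le_0_iff)
qed

lemma cauchy_solution_mono:
  "cauchy_solution f D x0 x \<Longrightarrow> D \<subseteq> D' \<Longrightarrow> cauchy_solution f D' x0 x"
  by (auto simp: cauchy_solution_def)

lemma equilibrium_iff: "equilibrium f D c \<longleftrightarrow> c \<in> D \<and> f c = 0"
proof -
  have "f c = 0" if "((\<lambda>_. c) has_real_derivative f c) (at 1)"
    using that DERIV_const DERIV_unique by metis
  then show ?thesis
    by (auto simp: equilibrium_def cauchy_solution_def intro: order_refl zero_less_one)
qed

section \<open>Separation of variables for scalar equations\<close>

text \<open>The solution is the inverse of the travel time \<open>\<Phi> x = \<integral> 1 / f\<close>; the function \<open>L\<close> bounds \<open>\<Phi>\<close> from
  below, so that reaching \<open>b\<close> takes infinite time.\<close>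

lemma increasing_solution:
  fixes f :: "real \<Rightarrow> real"
  assumes x0: "x0 \<in> {a<..<b}"
    and contf: "continuous_on {a<..<b} f"
    and pos: "\<And>x. x \<in> {a<..<b} \<Longrightarrow> 0 < f x"
    and L: "\<And>x. x \<in> {a<..<b} \<Longrightarrow> (L has_real_derivative L' x) (at x)"
    and L': "\<And>x. x \<in> {a<..<b} \<Longrightarrow> f x * L' x \<le> 1"
    and lim: "filterlim L at_top (at_left b)"
  obtains x where "cauchy_solution f {a<..<b} x0 x" "filterlim x (at_left b) at_top"
proof -
  \<comment> \<open>Integrating from a base point strictly left of \<open>x0\<close> gives \<Phi> a
    two-sided derivative at \<open>x0\<close> itself; subtracting the second integral normalises
    \<Phi> to vanish there.\<close>
  define c where "c = (a + x0) / 2"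
  have c: "a < c" "c < x0" "x0 < b" using x0 by (auto simp: c_def)
  define \<Phi> where "\<Phi> = (\<lambda>x. integral {c..x} (\<lambda>u. 1 / f u) - integral {c..x0} (\<lambda>u. 1 / f u))"
  have \<Phi>: "(\<Phi> has_real_derivative 1 / f x) (at x)" if x: "c < x" "x < b" for x
  proof -
    define d where "d = (x + b) / 2"
    have d: "x < d" "d < b" using x by (auto simp: d_def)
    have "continuous_on {c..d} (\<lambda>u. 1 / f u)"
    proof (intro continuous_intros)
      show "continuous_on {c..d} f" using contf by (rule continuous_on_subset) (use c d in auto)
      show "\<forall>u\<in>{c..d}. f u \<noteq> 0"
      proof
        fix u assume "u \<in> {c..d}"
        with c d have "0 < f u" by (intro pos) auto
        then show "f u \<noteq> 0" by simp
      qed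
    qed
    from integral_has_real_derivative[OF this, of x] x d
    have "((\<lambda>x. integral {c..x} (\<lambda>u. 1 / f u)) has_real_derivative 1 / f x) (at x within {c..d})"
      by auto
    moreover have "at x within {c..d} = at x"
      using x d by (intro at_within_interior) auto
    ultimately show ?thesis
      unfolding \<Phi>_def by (auto intro!: derivative_eq_intros)
  qed
  have \<Phi>_mono: "\<Phi> u < \<Phi> v" if "x0 \<le> u" "u < v" "v < b" for u v
  proof (rule DERIV_pos_imp_increasing[OF \<open>u < v\<close>])
    fix w assume "u \<le> w" "w \<le> v"
    then have "(\<Phi> has_real_derivative 1 / f w) (at w)" "0 < 1 / f w"
      using that c by (auto intro!: \<Phi> pos)
    then show "\<exists>z. (\<Phi> has_real_derivative z) (at w) \<and> 0 < z" by blast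
  qed
  have \<Phi>_x0: "\<Phi> x0 = 0" by (simp add: \<Phi>_def)
  \<comment> \<open>As \<open>f\<close> is positive, the hypothesis on \<open>L'\<close> reads
    \<open>L' w \<le> 1 / f w\<close>, so \<Phi> grows at least as fast as \<open>L\<close>.\<close>
  have \<Phi>_ge: "L u - L x0 \<le> \<Phi> u" if u: "x0 \<le> u" "u < b" for u
  proof -
    have "\<Phi> x0 - L x0 \<le> \<Phi> u - L u"
    proof (rule DERIV_nonneg_imp_nondecreasing[OF \<open>x0 \<le> u\<close>])
      fix w assume "x0 \<le> w" "w \<le> u"
      then have w: "w \<in> {a<..<b}" "c < w" "w < b" using u c by auto
      have "((\<lambda>x. \<Phi> x - L x) has_real_derivative 1 / f w - L' w) (at w)"
        by (intro DERIV_diff \<Phi> L w)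
      moreover have "0 \<le> 1 / f w - L' w"
        using L'[OF w(1)] pos[OF w(1)] by (simp add: field_simps)
      ultimately show "\<exists>z. ((\<lambda>x. \<Phi> x - L x) has_real_derivative z) (at w) \<and> 0 \<le> z" by blast
    qed
    then show ?thesis by (simp add: \<Phi>_x0)
  qed
  have \<Phi>_cont: "continuous_on {x0..<b} \<Phi>"
    using c by (intro continuous_at_imp_continuous_on ballI DERIV_isCont[OF \<Phi>]) auto
  \<comment> \<open>Every time \<open>T\<close> is attained: \<open>L\<close> is unbounded near
    \<open>b\<close>, hence \<Phi> exceeds \<open>T\<close> somewhere, and the intermediate value
    theorem applies.\<close>
  have "\<exists>u. x0 \<le> u \<and> u < b \<and> \<Phi> u = T" if "0 \<le> T" for T
  proof -
    have "eventually (\<lambda>u. T + L x0 \<le> L u) (at_left b)"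
      using lim by (simp add: filterlim_at_top)
    moreover have "eventually (\<lambda>u. u \<in> {x0<..<b}) (at_left b)"
      using c by (intro eventually_at_left_real)
    ultimately have "eventually (\<lambda>u. T + L x0 \<le> L u \<and> u \<in> {x0<..<b}) (at_left b)"
      by (rule eventually_conj)
    then obtain u where u: "T + L x0 \<le> L u" "u \<in> {x0<..<b}"
      using eventually_happens[of _ "at_left b"] by (auto simp: trivial_limit_at_left_real)
    have "\<exists>w\<ge>x0. w \<le> u \<and> \<Phi> w = T"
    proof (rule IVT')
      show "\<Phi> x0 \<le> T" "T \<le> \<Phi> u" "x0 \<le> u" using \<Phi>_ge[of u] u \<Phi>_x0 that by auto
      show "continuous_on {x0..u} \<Phi>" using \<Phi>_cont by (rule continuous_on_subset) (use u in auto)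
    qed
    then show ?thesis using u by auto
  qed
  then obtain x where x: "\<And>T. 0 \<le> T \<Longrightarrow> x0 \<le> x T" "\<And>T. 0 \<le> T \<Longrightarrow> x T < b"
      "\<And>T. 0 \<le> T \<Longrightarrow> \<Phi> (x T) = T"
    by metis
  have x_gt: "u < x T" if "x0 \<le> u" "u < b" "\<Phi> u < T" "0 \<le> T" for u T
  proof (rule ccontr)
    assume "\<not> u < x T"
    then have "\<Phi> (x T) \<le> \<Phi> u"
      using \<Phi>_mono[of "x T" u] x(1)[of T] that by (cases "x T = u") auto
    with that x(3)[of T] show False by auto
  qed
  have x_inv: "x (\<Phi> u) = u" if u: "x0 \<le> u" "u < b" for u
  proof -
    have "0 \<le> \<Phi> u" using \<Phi>_mono[of x0 u] u \<Phi>_x0 by (cases "u = x0") auto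
    then show ?thesis
      using \<Phi>_mono[of u "x (\<Phi> u)"] \<Phi>_mono[of "x (\<Phi> u)" u] x[of "\<Phi> u"] u
      by (cases u "x (\<Phi> u)" rule: linorder_cases) auto
  qed
  \<comment> \<open>The inverse of a continuous injection on the compact interval
    \<open>{x0..x T}\<close> is continuous on the image, which contains \<open>{0..T}\<close> by
    monotonicity.\<close>
  have x_cont: "continuous_on {0..T} x" if "0 \<le> T" for T
  proof -
    have "continuous_on (\<Phi> ` {x0..x T}) x"
    proof (rule continuous_on_inv)
      show "continuous_on {x0..x T} \<Phi>"
        using \<Phi>_cont by (rule continuous_on_subset) (use x(2)[OF that] in auto)
      show "\<forall>u\<in>{x0..x T}. x (\<Phi> u) = u" using x_inv x(2)[OF that] by auto
    qed simp
    moreover have "{0..T} \<subseteq> \<Phi> ` {x0..x T}"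
    proof
      fix t assume t: "t \<in> {0..T}"
      have "x t \<le> x T"
      proof (rule ccontr)
        assume "\<not> x t \<le> x T"
        then have "\<Phi> (x T) < \<Phi> (x t)" using \<Phi>_mono[of "x T" "x t"] x t that by auto
        then show False using x(3)[of T] x(3)[of t] t by auto
      qed
      then show "t \<in> \<Phi> ` {x0..x T}"
        using x(1)[of t] x(3)[of t] t by (intro image_eqI[of _ _ "x t"]) auto
    qed
    ultimately show ?thesis by (rule continuous_on_subset)
  qed
  have x_isCont: "isCont x T" if "0 < T" for T
    using x_cont[of "T + 1"] that by (intro continuous_on_interior[of "{0..T + 1}"]) auto
  have "continuous_on {0..} x"
    unfolding continuous_on_eq_continuous_within
  proof
    fix T :: real assume T: "T \<in> {0..}"
    then have "continuous (at T within {0..T + 1}) x"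
      using x_cont[of "T + 1"] by (auto simp: continuous_on_eq_continuous_within)
    moreover have "at T within {0..T + 1} = at T within {0..}"
      by (rule at_within_nhd[of _ "{..<T + 1}"]) auto
    ultimately show "continuous (at T within {0..}) x" by simp
  qed
  moreover have "(x has_real_derivative f (x T)) (at T)" if "0 < T" for T
  proof -
    have xT: "c < x T" "x T < b" using x[of T] that c by auto
    have "(x has_real_derivative inverse (1 / f (x T))) (at T)"
    \<comment> \<open>On \<open>{0<..<T + 1}\<close>, a neighbourhood of \<open>T\<close>, \<Phi> is
      a left inverse of \<open>x\<close>.\<close>
    proof (rule DERIV_inverse_function[where a = 0 and b = "T + 1"])
      show "(\<Phi> has_real_derivative 1 / f (x T)) (at (x T))" by (rule \<Phi>[OF xT])
      show "1 / f (x T) \<noteq> 0" using pos[of "x T"] xT c by auto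
    qed (use that x x_isCont in auto)
    then show ?thesis by simp
  qed
  moreover have "x 0 = x0" using x_inv[of x0] c \<Phi>_x0 by simp
  moreover have "x T \<in> {a<..<b}" if "0 \<le> T" for T using x[OF that] c by auto
  ultimately have "cauchy_solution f {a<..<b} x0 x" by (simp add: cauchy_solution_def)
  moreover have "filterlim x (at_left b) at_top"
    unfolding filterlim_at
  proof
    show "\<forall>\<^sub>F T in at_top. x T \<in> {..<b} \<and> x T \<noteq> b"
      using eventually_ge_at_top[of "0::real"] by eventually_elim (use x(2) in force)
    show "(x \<longlongrightarrow> b) at_top"
    proof (rule order_tendstoI)
      fix u assume "u < b"
      \<comment> \<open>The level \<open>u\<close> may lie left of \<open>x0\<close>, where \<Phi>
        is not controlled, so it is raised to \<open>max u x0\<close>.\<close>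
      then have m: "max u x0 < b" using c by auto
      show "\<forall>\<^sub>F T in at_top. u < x T"
        using eventually_gt_at_top[of "\<Phi> (max u x0)"] eventually_ge_at_top[of 0]
      proof eventually_elim
        case (elim T)
        then show ?case using x_gt[of "max u x0" T] m by auto
      qed
    next
      fix u assume "b < u"
      show "\<forall>\<^sub>F T in at_top. x T < u"
        using eventually_ge_at_top[of 0]
      proof eventually_elim
        case (elim T)
        then show ?case using x(2)[of T] \<open>b < u\<close> by auto
      qed
    qed
  qed
  ultimately show ?thesis by (rule that)
qed

text \<open>Reflection \<open>u \<mapsto> - u\<close> reduces this to the increasing case. Both
  \<open>f\<close> and \<open>L'\<close> change sign, so the bound on their product is
  preserved.\<close>

lemma decreasing_solution:
  fixes f :: "real \<Rightarrow> real"
  assumes x0: "x0 \<in> {a<..<b}"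
    and contf: "continuous_on {a<..<b} f"
    and neg: "\<And>x. x \<in> {a<..<b} \<Longrightarrow> f x < 0"
    and L: "\<And>x. x \<in> {a<..<b} \<Longrightarrow> (L has_real_derivative L' x) (at x)"
    and L': "\<And>x. x \<in> {a<..<b} \<Longrightarrow> f x * L' x \<le> 1"
    and lim: "filterlim L at_top (at_right a)"
  obtains x where "cauchy_solution f {a<..<b} x0 x" "filterlim x (at_right a) at_top"
proof -
  obtain y where y: "cauchy_solution (\<lambda>u. - f (- u)) {- b<..<- a} (- x0) y"
      "filterlim y (at_left (- a)) at_top"
  proof (rule increasing_solution[where ?x0.0 = "- x0" and a = "- b" and b = "- a"
        and f = "\<lambda>u. - f (- u)" and L = "\<lambda>u. L (- u)" and L' = "\<lambda>u. - L' (- u)"])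
    show "- x0 \<in> {- b<..<- a}" using x0 by auto
    show "continuous_on {- b<..<- a} (\<lambda>u. - f (- u))"
      by (intro continuous_intros continuous_on_compose2[OF contf]) auto
    show "0 < - f (- u)" if "u \<in> {- b<..<- a}" for u using neg[of "- u"] that by auto
    show "((\<lambda>u. L (- u)) has_real_derivative - L' (- u)) (at u)" if "u \<in> {- b<..<- a}" for u
      using L[of "- u"] that by (intro DERIV_cong[OF DERIV_chain2[where f = L and g = uminus]])
        (auto intro!: derivative_eq_intros)
    show "- f (- u) * - L' (- u) \<le> 1" if "u \<in> {- b<..<- a}" for u using L'[of "- u"] that by auto
    show "filterlim (\<lambda>u. L (- u)) at_top (at_left (- a))"
      using lim by (simp add: at_left_minus[of "- a"] filterlim_filtermap)
  qed
  have "cauchy_solution f {a<..<b} x0 (\<lambda>T. - y T)"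
    using y(1) unfolding cauchy_solution_def
    by (auto intro!: continuous_intros derivative_eq_intros)
  moreover have "filterlim uminus (at_right a) (at_left (- a))"
    by (simp add: filterlim_def at_right_minus[of a])
  then have "filterlim (\<lambda>T. - y T) (at_right a) at_top"
    using y(2) by (rule filterlim_compose)
  ultimately show ?thesis by (rule that)
qed

section \<open>Sign and bounds of the bracket\<close>

definition bracket :: "real \<Rightarrow> real" where
  "bracket x = (4 - x\<^sup>2) / (4 + x\<^sup>2) + 2 * ln (4 * x / (4 + x\<^sup>2))"

text \<open>The derivative of \<open>bracket\<close> over a common denominator, which is positive
  for \<open>x > 0\<close>; the sign is then that of a polynomial.\<close>

definition bracket' :: "real \<Rightarrow> real" where
  "bracket' x = 2 * (16 - 8 * x\<^sup>2 - x ^ 4) / (x * (4 + x\<^sup>2)\<^sup>2)"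

lemma Ghat_eq: "Ghat s x = 4 * s\<^sup>2 * x * bracket x"
  by (simp add: Ghat_def bracket_def)

lemma four_plus_square_pos: "0 < 4 + (x::real)\<^sup>2"
  by (smt (verit) zero_le_power2)

lemma bracket_deriv:
  assumes "0 < x"
  shows "(bracket has_real_derivative bracket' x) (at x)"
proof -
  have ne: "4 + x\<^sup>2 \<noteq> 0" using four_plus_square_pos[of x] by simp
  have "(bracket has_real_derivative
      ((- 2 * x) * (4 + x\<^sup>2) - (4 - x\<^sup>2) * (2 * x)) / (4 + x\<^sup>2)\<^sup>2
      + 2 * ((4 * (4 + x\<^sup>2) - 4 * x * (2 * x)) / (4 + x\<^sup>2)\<^sup>2 / (4 * x / (4 + x\<^sup>2)))) (at x)"
    unfolding bracket_def [abs_def] using assms ne four_plus_square_pos[of x]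
    by (auto intro!: derivative_eq_intros simp: power2_eq_square)
  moreover have "((- 2 * x) * (4 + x\<^sup>2) - (4 - x\<^sup>2) * (2 * x)) / (4 + x\<^sup>2)\<^sup>2
      + 2 * ((4 * (4 + x\<^sup>2) - 4 * x * (2 * x)) / (4 + x\<^sup>2)\<^sup>2 / (4 * x / (4 + x\<^sup>2))) = bracket' x"
    unfolding bracket'_def using assms ne
    by (simp add: divide_simps) algebra
  ultimately show ?thesis by simp
qed

text \<open>From \<open>(x - 2)\<^sup>2 \<ge> 0\<close> one gets
  \<open>4 * x \<le> 4 + x\<^sup>2\<close>, so the argument of the logarithm is at most
  \<open>1\<close>.\<close>

lemma ln_le_0_bracket: "0 < x \<Longrightarrow> ln (4 * x / (4 + x\<^sup>2)) \<le> (0::real)"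
  using four_plus_square_pos[of x] zero_le_power2[of "x - 2"]
  by (simp add: power2_diff)

text \<open>The logarithm is nonpositive, and the denominator of the fraction is at least
  \<open>4\<close>. The first bound controls the approach to \<open>2\<close>, the second enters the
  Lipschitz constant.\<close>

lemma bracket_le:
  assumes "0 < x" "x < 2"
  shows "bracket x \<le> 2 - x" "bracket x \<le> 1"
proof -
  have sq: "x\<^sup>2 \<le> 2 * x" using assms by (simp add: power2_eq_square)
  have "(4 - x\<^sup>2) / (4 + x\<^sup>2) \<le> (4 - x\<^sup>2) / 4"
    using assms sq four_plus_square_pos[of x] by (intro divide_left_mono) auto
  moreover have "(4 - x\<^sup>2) / 4 \<le> 2 - x"
    using assms zero_le_power2[of "x - 2"] by (simp add: power2_diff)
  moreover have "(4 - x\<^sup>2) / 4 \<le> 1" by simp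
  ultimately show "bracket x \<le> 2 - x" "bracket x \<le> 1"
    using ln_le_0_bracket[OF assms(1)] unfolding bracket_def by linarith+
qed

text \<open>The fraction is nonnegative, and \<open>4 + x\<^sup>2 \<le> 8\<close> bounds the
  logarithm from below. This controls the approach to \<open>0\<close>.\<close>

lemma bracket_ge:
  assumes "0 < x" "x < 2"
  shows "2 * ln (x / 2) \<le> bracket x"
proof -
  have "x\<^sup>2 < 4" using assms power_strict_mono[of x 2 2] by simp
  then have "0 \<le> (4 - x\<^sup>2) / (4 + x\<^sup>2)" by simp
  moreover have "ln (x / 2) \<le> ln (4 * x / (4 + x\<^sup>2))"
  proof (rule ln_mono)
    have "x * (4 + x\<^sup>2) \<le> x * 8" using assms \<open>x\<^sup>2 < 4\<close> by (intro mult_left_mono) auto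
    then show "x / 2 \<le> 4 * x / (4 + x\<^sup>2)"
      using four_plus_square_pos[of x] by (simp add: field_simps)
  qed (use assms in auto)
  ultimately show ?thesis by (simp add: bracket_def)
qed

lemma bracket_2: "bracket 2 = 0"
  by (simp add: bracket_def)

text \<open>The value is \<open>55/73 + 2 * ln (48/73)\<close>. The estimate
  \<open>ln y \<le> y - 1\<close> is too weak at \<open>48/73\<close> itself but suffices at
  \<open>87/100\<close>, which is slightly above its cube root.\<close>

lemma bracket_three_quarters: "bracket (3/4) < 0"
proof -
  have "ln (48/73 :: real) < ln ((87/100) ^ 3)" by (subst ln_less_cancel_iff) (simp_all add: power3_eq_cube)
  also have "\<dots> = 3 * ln (87/100)" by (simp add: ln_realpow)
  also have "\<dots> \<le> 3 * (87/100 - 1)" using ln_le_minus_one[of "87/100::real"] by simp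
  finally show ?thesis by (simp add: bracket_def power2_eq_square)
qed

text \<open>The value is \<open>1311/1889 + 2 * ln (1360/1889)\<close>. Here
  \<open>1086/1000\<close> slightly exceeds the fourth root of \<open>1889/1360\<close>, close
  enough to \<open>1\<close> for \<open>ln y \<le> y - 1\<close>.\<close>

lemma bracket_17_20: "0 < bracket (17/20)"
proof -
  have "- ln (1360/1889 :: real) = ln (1889/1360)" by (simp add: ln_div)
  also have "\<dots> < ln ((1086/1000) ^ 4)" by (subst ln_less_cancel_iff) (simp_all add: power4_eq_xxxx)
  also have "\<dots> = 4 * ln (1086/1000)" by (simp add: ln_realpow)
  also have "\<dots> \<le> 4 * (1086/1000 - 1)" using ln_le_minus_one[of "1086/1000::real"] by simp
  finally show ?thesis by (simp add: bracket_def power2_eq_square)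
qed

lemma
  assumes "0 < x"
  shows bracket'_pos_iff: "0 < bracket' x \<longleftrightarrow> 0 < 16 - 8 * x\<^sup>2 - x ^ 4"
    and bracket'_neg_iff: "bracket' x < 0 \<longleftrightarrow> 16 - 8 * x\<^sup>2 - x ^ 4 < 0"
proof -
  have "0 < x * (4 + x\<^sup>2)\<^sup>2" using assms four_plus_square_pos[of x] by simp
  then show "0 < bracket' x \<longleftrightarrow> 0 < 16 - 8 * x\<^sup>2 - x ^ 4"
      "bracket' x < 0 \<longleftrightarrow> 16 - 8 * x\<^sup>2 - x ^ 4 < 0"
    unfolding bracket'_def by (simp_all only: zero_less_divide_iff divide_less_0_iff, auto)
qed

text \<open>Hence \<open>bracket'\<close> changes sign at most once on the positive axis, from
  positive to negative.\<close>

lemma bracket'_numerator_decreasing: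
  "0 \<le> x \<Longrightarrow> x < y \<Longrightarrow> 16 - 8 * y\<^sup>2 - y ^ 4 < 16 - 8 * x\<^sup>2 - x ^ (4::nat)" for x y :: real
  using power_strict_mono[of x y 2] power_strict_mono[of x y 4] by simp

lemma bracket_increasing:
  assumes "0 < x" "x < y" "0 \<le> 16 - 8 * y\<^sup>2 - y ^ 4"
  shows "bracket x < bracket y"
proof (rule DERIV_pos_imp_increasing_open[OF \<open>x < y\<close>])
  fix z assume z: "x < z" "z < y"
  then have "0 < bracket' z"
    using assms bracket'_numerator_decreasing[of z y] by (simp add: bracket'_pos_iff)
  then show "\<exists>d. (bracket has_real_derivative d) (at z) \<and> 0 < d"
    using bracket_deriv[of z] z assms by auto
qed (use assms in \<open>auto intro!: continuous_at_imp_continuous_on DERIV_isCont[OF bracket_deriv]\<close>)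

text \<open>Either \<open>x\<close> is still on the rising branch and is compared with
  \<open>c\<close>, or \<open>bracket\<close> falls strictly from \<open>x\<close> to its value
  \<open>0\<close> at \<open>2\<close>.\<close>

lemma bracket_pos_right:
  assumes c: "0 < c" "bracket c = 0" and x: "c < x" "x < 2"
  shows "0 < bracket x"
proof (cases "0 \<le> 16 - 8 * x\<^sup>2 - x ^ 4")
  case True
  then show ?thesis using bracket_increasing[of c x] c x by simp
next
  case False
  have "bracket 2 < bracket x"
  proof (rule DERIV_neg_imp_decreasing[OF x(2)])
    fix z assume z: "x \<le> z" "z \<le> 2"
    then have "bracket' z < 0"
      using False c x bracket'_numerator_decreasing[of x z]
      by (cases "x = z") (auto simp: bracket'_neg_iff)
    then show "\<exists>d. (bracket has_real_derivative d) (at z) \<and> d < 0"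
      using bracket_deriv[of z] z c x by auto
  qed
  then show ?thesis by (simp add: bracket_2)
qed

text \<open>The numerator of \<open>bracket'\<close> is positive at \<open>17/20\<close>, so
  \<open>c\<close> lies on the rising branch.\<close>

lemma bracket_neg_left:
  assumes "0 < x" "x < c" "c < 17/20" "bracket c = 0"
  shows "bracket x < 0"
proof -
  have "0 \<le> 16 - 8 * c\<^sup>2 - c ^ 4"
    using bracket'_numerator_decreasing[of c "17/20"] assms
    by (simp add: power2_eq_square power4_eq_xxxx)
  then show ?thesis using bracket_increasing[of x c] assms by simp
qed

text \<open>Intermediate value theorem between the two evaluated points, which are exactly
  \<open>0.8 - 0.05\<close> and \<open>0.8 + 0.05\<close>; their nonzero values make the
  inequalities strict.\<close>

lemma bracket_zero_exists: "\<exists>c. 3/4 < c \<and> c < 17/20 \<and> bracket c = 0"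
proof -
  have "\<exists>c\<ge>3/4. c \<le> 17/20 \<and> bracket c = 0"
    by (rule IVT') (use bracket_three_quarters bracket_17_20 in
      \<open>auto intro!: continuous_at_imp_continuous_on DERIV_isCont[OF bracket_deriv]\<close>)
  then show ?thesis
    using bracket_three_quarters bracket_17_20 by (metis less_eq_real_def less_irrefl)
qed

section \<open>Derivative, Lipschitz bound and asymptotics of \<open>Ghat\<close>\<close>

lemma Ghat_deriv:
  "0 < x \<Longrightarrow> (Ghat s has_real_derivative 4 * s\<^sup>2 * (bracket x + x * bracket' x)) (at x)"
  unfolding Ghat_eq[abs_def]
  by (rule derivative_eq_intros bracket_deriv refl | simp add: algebra_simps)+

lemma Ghat_cont: "S \<subseteq> {0<..} \<Longrightarrow> continuous_on S (Ghat s)"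
  by (intro continuous_at_imp_continuous_on ballI DERIV_isCont[OF Ghat_deriv]) auto

text \<open>The constant is \<open>4 * (1 + 2)\<close>: \<open>bracket x \<le> 1\<close>, and
  \<open>x * bracket' x \<le> 2\<close> because
  \<open>16 - 8 * x\<^sup>2 - x ^ 4 \<le> (4 + x\<^sup>2)\<^sup>2\<close>.\<close>

lemma Ghat_deriv_le:
  assumes "0 < x" "x < 2"
  shows "4 * s\<^sup>2 * (bracket x + x * bracket' x) \<le> 12 * s\<^sup>2"
proof -
  have "x * bracket' x = 2 * (16 - 8 * x\<^sup>2 - x ^ 4) / (4 + x\<^sup>2)\<^sup>2"
    using assms by (simp add: bracket'_def)
  also have "\<dots> \<le> 2"
  proof -
    have "2 * (4 + x\<^sup>2)\<^sup>2 - 2 * (16 - 8 * x\<^sup>2 - x ^ 4) = 32 * x\<^sup>2 + 4 * x ^ 4" by algebra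
    moreover have "0 \<le> 32 * x\<^sup>2 + 4 * x ^ 4" by simp
    ultimately have "2 * (16 - 8 * x\<^sup>2 - x ^ 4) \<le> 2 * (4 + x\<^sup>2)\<^sup>2" by (metis diff_ge_0_iff_ge)
    then show ?thesis using four_plus_square_pos[of x] by (simp add: divide_le_eq)
  qed
  finally have "bracket x + x * bracket' x \<le> 3" using bracket_le[OF assms] by simp
  then have "(4 * s\<^sup>2) * (bracket x + x * bracket' x) \<le> (4 * s\<^sup>2) * 3"
    by (intro mult_left_mono) auto
  then show ?thesis by simp
qed

text \<open>Only one-sided: the derivative of \<open>Ghat s\<close> is unbounded below at \<open>0\<close>.\<close>

lemma Ghat_one_sided_Lipschitz:
  assumes "u \<in> {0<..<2}" "v \<in> {0<..<2}"
  shows "(Ghat s u - Ghat s v) * (u - v) \<le> 12 * s\<^sup>2 * (u - v)\<^sup>2"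
proof -
  \<comment> \<open>The ordered case comes from the derivative bound; the claim is symmetric in
    \<open>u\<close> and \<open>v\<close>.\<close>
  have *: "Ghat s y - Ghat s x \<le> 12 * s\<^sup>2 * (y - x)" if "0 < x" "x \<le> y" "y < 2" for x y
  proof -
    have "12 * s\<^sup>2 * x - Ghat s x \<le> 12 * s\<^sup>2 * y - Ghat s y"
    proof (rule DERIV_nonneg_imp_nondecreasing[OF \<open>x \<le> y\<close>])
      fix z assume z: "x \<le> z" "z \<le> y"
      have "((\<lambda>x. 12 * s\<^sup>2 * x - Ghat s x) has_real_derivative
          12 * s\<^sup>2 - 4 * s\<^sup>2 * (bracket z + z * bracket' z)) (at z)"
        using z that by (auto intro!: derivative_eq_intros Ghat_deriv)
      moreover have "0 \<le> 12 * s\<^sup>2 - 4 * s\<^sup>2 * (bracket z + z * bracket' z)"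
        using Ghat_deriv_le[of z s] z that by simp
      ultimately show "\<exists>d. ((\<lambda>x. 12 * s\<^sup>2 * x - Ghat s x) has_real_derivative d) (at z) \<and> 0 \<le> d"
        by blast
    qed
    then show ?thesis by (simp add: algebra_simps)
  qed
  show ?thesis
  proof (cases "v \<le> u")
    case True
    then have "(Ghat s u - Ghat s v) * (u - v) \<le> (12 * s\<^sup>2 * (u - v)) * (u - v)"
      using assms by (intro mult_right_mono *) auto
    then show ?thesis by (simp add: power2_eq_square mult.assoc)
  next
    case False
    then have "(Ghat s v - Ghat s u) * (v - u) \<le> (12 * s\<^sup>2 * (v - u)) * (v - u)"
      using assms by (intro mult_right_mono *) auto
    then show ?thesis by (simp add: power2_eq_square algebra_simps)
  qed
qed

lemma Ghat_asymp_0: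
  assumes "s \<noteq> 0"
  shows "(\<lambda>x. Ghat s x / s\<^sup>2) \<sim>[at_right 0] (\<lambda>x. 8 * x * ln x)"
proof -
  have "Ghat s x / s\<^sup>2 = 4 * x * bracket x" for x using assms by (simp add: Ghat_eq)
  then show ?thesis unfolding bracket_def by simp real_asymp
qed

text \<open>At \<open>2\<close> the bracket vanishes with slope \<open>- 1/2\<close>, and the
  prefactor \<open>4 * x\<close> tends to \<open>8\<close>.\<close>

lemma Ghat_asymp_2:
  assumes "s \<noteq> 0"
  shows "(\<lambda>x. Ghat s x / s\<^sup>2) \<sim>[at_left 2] (\<lambda>x. 4 * (2 - x))"
proof -
  have "Ghat s x / s\<^sup>2 = 4 * x * bracket x" for x using assms by (simp add: Ghat_eq)
  then show ?thesis unfolding bracket_def by simp real_asymp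
qed

section \<open>Long-time behaviour and instability\<close>

text \<open>On \<open>{0<..<c}\<close> the field is negative. The chosen \<open>L\<close> is an
  antiderivative of the reciprocal of the comparison field
  \<open>8 * s\<^sup>2 * x * ln (x / 2)\<close>; its double logarithm diverges at
  \<open>0\<close>.\<close>

lemma Ghat_solution_to_0:
  assumes s: "s \<noteq> 0" and c: "c < 17/20" "bracket c = 0" and x0: "0 < x0" "x0 < c"
  obtains x where "cauchy_solution (Ghat s) {0<..<2} x0 x" "filterlim x (at_right 0) at_top"
proof -
  obtain x where "cauchy_solution (Ghat s) {0<..<c} x0 x" "filterlim x (at_right 0) at_top"
  proof (rule decreasing_solution[where f = "Ghat s" and a = 0 and b = c and ?x0.0 = x0
        and L = "\<lambda>x. ln (- ln (x / 2)) / (8 * s\<^sup>2)" and L' = "\<lambda>x. 1 / (8 * s\<^sup>2 * x * ln (x / 2))"])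
    show "continuous_on {0<..<c} (Ghat s)" by (rule Ghat_cont) auto
    show "x0 \<in> {0<..<c}" using x0 by simp
    show "Ghat s x < 0" if "x \<in> {0<..<c}" for x
      using bracket_neg_left[of x c] that c s by (simp add: Ghat_eq mult_pos_neg)
    show "((\<lambda>x. ln (- ln (x / 2)) / (8 * s\<^sup>2)) has_real_derivative 1 / (8 * s\<^sup>2 * x * ln (x / 2))) (at x)"
      if "x \<in> {0<..<c}" for x
      using that c s by (auto intro!: derivative_eq_intros simp: divide_simps)
    show "Ghat s x * (1 / (8 * s\<^sup>2 * x * ln (x / 2))) \<le> 1" if "x \<in> {0<..<c}" for x
    proof -
      have x: "0 < x" "x < 2" using that c by auto
      have "ln (x / 2) < 0" using x by simp
      have "Ghat s x * (1 / (8 * s\<^sup>2 * x * ln (x / 2))) = bracket x / (2 * ln (x / 2))"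
        using s x by (simp add: Ghat_eq)
      \<comment> \<open>Dividing \<open>bracket_ge\<close> by the negative number
        \<open>2 * ln (x / 2)\<close> reverses the inequality.\<close>
      also have "\<dots> \<le> 1"
        using bracket_ge[OF x] \<open>ln (x / 2) < 0\<close> by (simp add: divide_le_eq)
      finally show ?thesis .
    qed
    have "filterlim (\<lambda>x::real. ln (- ln (x / 2))) at_top (at_right 0)" by real_asymp
    then show "filterlim (\<lambda>x. ln (- ln (x / 2)) / (8 * s\<^sup>2)) at_top (at_right 0)"
      using s by (subst divide_inverse, subst filterlim_at_top_mult_tendsto_pos) auto
  qed
  moreover have "{0<..<c} \<subseteq> {0<..<2}" using c by auto
  ultimately show ?thesis using that cauchy_solution_mono by blast
qed

text \<open>On \<open>{c<..<2}\<close> the field is positive and at most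
  \<open>8 * s\<^sup>2 * (2 - x)\<close>, whose reciprocal has the antiderivative \<open>L\<close>,
  logarithmically divergent at \<open>2\<close>.\<close>

lemma Ghat_solution_to_2:
  assumes s: "s \<noteq> 0" and c: "0 < c" "bracket c = 0" and x0: "c < x0" "x0 < 2"
  obtains x where "cauchy_solution (Ghat s) {0<..<2} x0 x" "filterlim x (at_left 2) at_top"
proof -
  obtain x where "cauchy_solution (Ghat s) {c<..<2} x0 x" "filterlim x (at_left 2) at_top"
  proof (rule increasing_solution[where f = "Ghat s" and a = c and b = 2 and ?x0.0 = x0
        and L = "\<lambda>x. - ln (2 - x) / (8 * s\<^sup>2)" and L' = "\<lambda>x. 1 / (8 * s\<^sup>2 * (2 - x))"])
    show "continuous_on {c<..<2} (Ghat s)" by (rule Ghat_cont) (use c in auto)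
    show "x0 \<in> {c<..<2}" using x0 by simp
    show "0 < Ghat s x" if "x \<in> {c<..<2}" for x
      using bracket_pos_right[of c x] that c s by (simp add: Ghat_eq)
    show "((\<lambda>x. - ln (2 - x) / (8 * s\<^sup>2)) has_real_derivative 1 / (8 * s\<^sup>2 * (2 - x))) (at x)"
      if "x \<in> {c<..<2}" for x
      using that c s by (auto intro!: derivative_eq_intros simp: divide_simps)
    show "Ghat s x * (1 / (8 * s\<^sup>2 * (2 - x))) \<le> 1" if "x \<in> {c<..<2}" for x
    proof -
      have x: "0 < x" "x < 2" using that c by auto
      have "x * bracket x \<le> 2 * (2 - x)"
        using bracket_le(1)[OF x] bracket_pos_right[of c x] that c x by (intro mult_mono) auto
      then have "(4 * s\<^sup>2) * (x * bracket x) \<le> (4 * s\<^sup>2) * (2 * (2 - x))"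
        by (intro mult_left_mono) auto
      then show ?thesis using s x by (simp add: Ghat_eq divide_le_eq mult.assoc)
    qed
    have "filterlim (\<lambda>x::real. - ln (2 - x)) at_top (at_left 2)" by real_asymp
    then show "filterlim (\<lambda>x. - ln (2 - x) / (8 * s\<^sup>2)) at_top (at_left 2)"
      using s by (subst divide_inverse, subst filterlim_at_top_mult_tendsto_pos) auto
  qed
  moreover have "{c<..<2} \<subseteq> {0<..<2}" using c by auto
  ultimately show ?thesis using that cauchy_solution_mono by blast
qed

text \<open>Solutions starting arbitrarily close to \<open>c\<close> on its right converge to
  \<open>2\<close>, at distance more than \<open>1\<close> from \<open>c\<close>, so stability fails
  for \<epsilon> equal to \<open>1\<close>.\<close>

lemma Ghat_unstable:
  assumes s: "s \<noteq> 0" and c: "0 < c" "c < 1" "bracket c = 0"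
  shows "unstable_equilibrium (Ghat s) {0<..<2} c"
proof -
  have "\<not> stable_equilibrium (Ghat s) {0<..<2} c"
  proof
    assume "stable_equilibrium (Ghat s) {0<..<2} c"
    then obtain \<delta> where \<delta>: "\<delta> > 0" and near: "\<And>x0 x T. x0 \<in> {0<..<2} \<Longrightarrow> \<bar>x0 - c\<bar> < \<delta> \<Longrightarrow>
        cauchy_solution (Ghat s) {0<..<2} x0 x \<Longrightarrow> T \<ge> 0 \<Longrightarrow> \<bar>x T - c\<bar> < 1"
      unfolding stable_equilibrium_def by (meson zero_less_one)
    \<comment> \<open>The minimum keeps \<open>x0\<close> within \<delta> of \<open>c\<close> and,
      since \<open>c < 1\<close>, below \<open>2\<close>.\<close>
    define x0 where "x0 = c + min (\<delta> / 2) 1"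
    have x0: "c < x0" "x0 < 2" "\<bar>x0 - c\<bar> < \<delta>" using \<delta> c by (auto simp: x0_def min_def)
    obtain x where x: "cauchy_solution (Ghat s) {0<..<2} x0 x" "filterlim x (at_left 2) at_top"
      using Ghat_solution_to_2[OF s c(1,3) x0(1,2)] by blast
    have "(x \<longlongrightarrow> 2) at_top" using x(2) by (simp add: filterlim_at)
    then have "\<forall>\<^sub>F T in at_top. c + 1 < x T" by (rule order_tendstoD) (use c in simp)
    then have "\<forall>\<^sub>F T::real in at_top. c + 1 < x T \<and> 0 \<le> T"
      using eventually_ge_at_top by (rule eventually_conj)
    then obtain T where "c + 1 < x T" "0 \<le> T"
      by (auto simp: eventually_at_top_linorder)
    then show False using near[OF _ x0(3) x(1)] x0 c by force
  qed
  then show ?thesis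
    using c by (simp add: unstable_equilibrium_def equilibrium_iff Ghat_eq)
qed

theorem mainTheorem3:
  fixes s :: real
  assumes "s \<noteq> 0"
  shows "\<exists>\<Delta>eq::real.
    {\<Delta> \<in> {0<..<2}. Ghat s \<Delta> = 0} = {\<Delta>eq} \<and> \<bar>\<Delta>eq - 0.8\<bar> < 0.05 \<and>
    asymp_equiv (\<lambda>\<Delta>. Ghat s \<Delta> / s\<^sup>2) (at_right 0) (\<lambda>\<Delta>. 8 * \<Delta> * ln \<Delta>) \<and>
    asymp_equiv (\<lambda>\<Delta>. Ghat s \<Delta> / s\<^sup>2) (at_left 2) (\<lambda>\<Delta>. 4 * (2 - \<Delta>)) \<and>
    {\<Delta>. equilibrium (Ghat s) {0<..<2} \<Delta>} = {\<Delta>eq} \<and>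
    unstable_equilibrium (Ghat s) {0<..<2} \<Delta>eq \<and>
    (\<forall>\<Delta>0\<in>{0<..<2}. \<exists>\<Delta>.
       cauchy_solution (Ghat s) {0<..<2} \<Delta>0 \<Delta> \<and>
       (\<forall>y. cauchy_solution (Ghat s) {0<..<2} \<Delta>0 y \<longrightarrow> (\<forall>T\<ge>0. y T = \<Delta> T)) \<and>
       (\<Delta>0 < \<Delta>eq \<longrightarrow> filterlim \<Delta> (at_right 0) at_top) \<and>
       (\<Delta>0 > \<Delta>eq \<longrightarrow> filterlim \<Delta> (at_left 2) at_top))"
proof -
  obtain c where c: "3/4 < c" "c < 17/20" "bracket c = 0"
    using bracket_zero_exists by blast
  have zero_iff: "Ghat s x = 0 \<longleftrightarrow> x = c" if "x \<in> {0<..<2}" for x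
    using that assms c bracket_pos_right[of c x] bracket_neg_left[of x c]
    by (cases x c rule: linorder_cases) (auto simp: Ghat_eq)
  have c_in: "c \<in> {0<..<2}" using c by auto
  show ?thesis
  proof (intro exI[of _ c] conjI ballI)
    show "{x \<in> {0<..<2}. Ghat s x = 0} = {c}" using zero_iff c_in by blast
    show "\<bar>c - 0.8\<bar> < 0.05" unfolding abs_less_iff using c by simp
    show "(\<lambda>x. Ghat s x / s\<^sup>2) \<sim>[at_right 0] (\<lambda>x. 8 * x * ln x)"
      using assms by (rule Ghat_asymp_0)
    show "(\<lambda>x. Ghat s x / s\<^sup>2) \<sim>[at_left 2] (\<lambda>x. 4 * (2 - x))"
      using assms by (rule Ghat_asymp_2)
    show "{x. equilibrium (Ghat s) {0<..<2} x} = {c}"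
      using zero_iff c_in by (auto simp: equilibrium_iff)
    show "unstable_equilibrium (Ghat s) {0<..<2} c"
      using assms c by (intro Ghat_unstable) auto
    fix x0 :: real assume x0: "x0 \<in> {0<..<2}"
    \<comment> \<open>Existence splits according to the side of \<open>c\<close>, with the constant
      solution at \<open>c\<close>; uniqueness is added afterwards for all three cases at
      once.\<close>
    have "\<exists>x. cauchy_solution (Ghat s) {0<..<2} x0 x \<and>
        (x0 < c \<longrightarrow> filterlim x (at_right 0) at_top) \<and> (c < x0 \<longrightarrow> filterlim x (at_left 2) at_top)"
    proof (cases x0 c rule: linorder_cases)
      case less
      then show ?thesis
        using Ghat_solution_to_0[of s c x0] assms c x0 by (metis greaterThanLessThan_iff less_asym')
    next
      case equal
      then have "equilibrium (Ghat s) {0<..<2} x0"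
        using zero_iff c_in by (auto simp: equilibrium_iff)
      with equal show ?thesis by (auto simp: equilibrium_def)
    next
      case greater
      then show ?thesis
        using Ghat_solution_to_2[of s c x0] assms c c_in x0 by (metis greaterThanLessThan_iff less_asym')
    qed
    then show "\<exists>x. cauchy_solution (Ghat s) {0<..<2} x0 x \<and>
       (\<forall>y. cauchy_solution (Ghat s) {0<..<2} x0 y \<longrightarrow> (\<forall>T\<ge>0. y T = x T)) \<and>
       (x0 < c \<longrightarrow> filterlim x (at_right 0) at_top) \<and>
       (x0 > c \<longrightarrow> filterlim x (at_left 2) at_top)"
      using cauchy_solution_unique[OF Ghat_one_sided_Lipschitz] by blast
  qed
qed

end
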